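(* Let $d>1$ be an integer, let $s$ be a real number with $s>d/2-1$, and let $$p(z_1,\ldots,z_d)=(1+s)\sum_{m=1}^dz_m^2-\Big(\sum_{m=1}^dz_m\Big)^2.$$ Then $\|p\|_\infty=(1+s)d$ if $d$ is even, and $\|p\|_\infty<(1+s)d$ if $d$ is odd, while $\|p\|_{\mathcal{A}}=(1+s)d$ for all $d$. In particular, $p/\|p\|_\infty$ is not in $\mathcal{SA}_d$ for odd $d>1$.
   Context: $\mathbb{D}^d=\{z\in\mathbb{C}^d:|z_i|<1,\ i=1,\dots,d\}$. For a scalar analytic function $f$ on $\mathbb{D}^d$, $\|f\|_\infty=\sup_{z\in\mathbb{D}^d}|f(z)|$ and $\|f\|_{\mathcal{A}}=\sup_T\|f(T)\|$, where the latter supremum is over all $d$-tuples $T=(T_1,\ldots,T_d)$ of commuting strict contractions on a common Hilbert space. The Schur--Agler class $\mathcal{SA}_d$ consists of the analytic functions $f$ on $\mathbb{D}^d$ with $\|f\|_{\mathcal{A}}\le1$. *)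

theory Defs
  imports "HOL-Analysis.Analysis" "HOL-Algebra.Algebraic_Closure_Type"
begin

section \<open>Analytic functions on the polydisc\<close>

definition polydisc :: "(complex ^ 'd::finite) set" where
  "polydisc = {z. \<forall>i. cmod (z $ i) < 1}"

definition sup_norm :: "(complex ^ 'd::finite \<Rightarrow> complex) \<Rightarrow> ereal" where
  "sup_norm f = (SUP z\<in>polydisc. ereal (cmod (f z)))"

definition has_power_series ::
    "(complex ^ 'd::finite \<Rightarrow> complex) \<Rightarrow> complex ^ 'd \<Rightarrow> (('d \<Rightarrow> nat) \<Rightarrow> complex) \<Rightarrow> bool" where
  "has_power_series f a c \<longleftrightarrow>
     (\<exists>r>0. \<forall>z. (\<forall>i. cmod (z $ i - a $ i) < r) \<longrightarrow>
        ((\<lambda>\<alpha>. c \<alpha> * (\<Prod>i\<in>UNIV. (z $ i - a $ i) ^ \<alpha> i)) has_sum f z) UNIV)"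

definition analytic_on_polydisc :: "(complex ^ 'd::finite \<Rightarrow> complex) \<Rightarrow> bool" where
  "analytic_on_polydisc f \<longleftrightarrow> (\<forall>a\<in>polydisc. \<exists>c. has_power_series f a c)"

definition taylor_coeff :: "(complex ^ 'd::finite \<Rightarrow> complex) \<Rightarrow> ('d \<Rightarrow> nat) \<Rightarrow> complex" where
  "taylor_coeff f = (THE c. has_power_series f 0 c)"


section \<open>Complex Hilbert spaces and operators on them\<close>

text \<open>
  A supremum over operator tuples on arbitrary Hilbert spaces cannot range over types, so a
  Hilbert space is a structure whose carrier is a subset of a type. The multiplication and unit
  fields of the underlying record are not used.
\<close>

record 'a hilbert = "(complex, 'a) module" +
  ip :: "'a \<Rightarrow> 'a \<Rightarrow> complex"

definition hnorm :: "('a, 'm) hilbert_scheme \<Rightarrow> 'a \<Rightarrow> real" where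
  "hnorm H x = sqrt (Re (ip H x x))"

text \<open>
  The locale \<^locale>\<open>Metric_space\<close> wants nonnegativity and symmetry of the distance also outside
  the carrier, hence the default value.
\<close>

definition hdist :: "('a, 'm) hilbert_scheme \<Rightarrow> 'a \<Rightarrow> 'a \<Rightarrow> real" where
  "hdist H x y = (if x \<in> carrier H \<and> y \<in> carrier H then hnorm H (x \<ominus>\<^bsub>H\<^esub> y) else 0)"

locale complex_hilbert_space =
  Module.module "ring_of_type_algebra :: complex ring" H for H :: "'a hilbert" (structure) +
  assumes ip_add_left:
      "\<lbrakk>x \<in> carrier H; y \<in> carrier H; z \<in> carrier H\<rbrakk> \<Longrightarrow> ip H (x \<oplus> y) z = ip H x z + ip H y z"
    and ip_smult_left:
      "\<lbrakk>x \<in> carrier H; y \<in> carrier H\<rbrakk> \<Longrightarrow> ip H (a \<odot> x) y = a * ip H x y"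
    and ip_commute:
      "\<lbrakk>x \<in> carrier H; y \<in> carrier H\<rbrakk> \<Longrightarrow> ip H y x = cnj (ip H x y)"
    and ip_pos:
      "\<lbrakk>x \<in> carrier H; x \<noteq> \<zero>\<rbrakk> \<Longrightarrow> Re (ip H x x) > 0"
    and complete: "Metric_space.mcomplete (carrier H) (hdist H)"

definition linear_operator :: "'a hilbert \<Rightarrow> ('a \<Rightarrow> 'a) \<Rightarrow> bool" where
  "linear_operator H A \<longleftrightarrow>
     A \<in> carrier H \<rightarrow> carrier H \<and>
     (\<forall>x\<in>carrier H. \<forall>y\<in>carrier H. A (x \<oplus>\<^bsub>H\<^esub> y) = A x \<oplus>\<^bsub>H\<^esub> A y) \<and>
     (\<forall>a. \<forall>x\<in>carrier H. A (a \<odot>\<^bsub>H\<^esub> x) = a \<odot>\<^bsub>H\<^esub> A x)"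

definition op_norm :: "'a hilbert \<Rightarrow> ('a \<Rightarrow> 'a) \<Rightarrow> ereal" where
  "op_norm H A = (SUP x\<in>{x \<in> carrier H. hnorm H x \<le> 1}. ereal (hnorm H (A x)))"

definition commuting_strict_contractions :: "'a hilbert \<Rightarrow> ('d::finite \<Rightarrow> 'a \<Rightarrow> 'a) \<Rightarrow> bool" where
  "commuting_strict_contractions H T \<longleftrightarrow>
     (\<forall>i. linear_operator H (T i) \<and> op_norm H (T i) < 1) \<and>
     (\<forall>i j. \<forall>x\<in>carrier H. T i (T j x) = T j (T i x))"

text \<open>
  The monomial $T^\alpha$. The product runs over some enumeration of the index type;
  for commuting operators the choice of the enumeration is irrelevant on the carrier.
\<close>

definition op_monomial :: "('d::finite \<Rightarrow> 'a \<Rightarrow> 'a) \<Rightarrow> ('d \<Rightarrow> nat) \<Rightarrow> 'a \<Rightarrow> 'a" where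
  "op_monomial T \<alpha> =
     foldr (\<lambda>i A. (T i ^^ \<alpha> i) \<circ> A) (SOME is. distinct is \<and> set is = UNIV) id"

text \<open>
  The operator $f(T) = \sum_\alpha c_\alpha T^\alpha$, where the $c_\alpha$ are the Taylor
  coefficients of $f$ at the origin. For an analytic function on the polydisc and commuting strict
  contractions the series converges absolutely in operator norm; the operator is recovered here by
  taking the (unconditional) sum at each vector.
\<close>

definition fun_calc ::
    "'a hilbert \<Rightarrow> (complex ^ 'd::finite \<Rightarrow> complex) \<Rightarrow> ('d \<Rightarrow> 'a \<Rightarrow> 'a) \<Rightarrow> 'a \<Rightarrow> 'a" where
  "fun_calc H f T x =
     (THE y. limitin (Metric_space.mtopology (carrier H) (hdist H))
        (\<lambda>F. \<Oplus>\<^bsub>H\<^esub>\<alpha>\<in>F. taylor_coeff f \<alpha> \<odot>\<^bsub>H\<^esub> op_monomial T \<alpha> x)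
        y (finite_subsets_at_top UNIV))"


section \<open>The Schur--Agler class\<close>

text \<open>
  The type argument is the universe of the Hilbert spaces: the supremum is over all
  Hilbert spaces whose carrier is a set of elements of type \<^typ>\<open>'a\<close>.
\<close>

definition agler_norm :: "'a itself \<Rightarrow> (complex ^ 'd::finite \<Rightarrow> complex) \<Rightarrow> ereal" where
  "agler_norm _ f =
     (SUP (H, T)\<in>{(H :: 'a hilbert, T). complex_hilbert_space H \<and> commuting_strict_contractions H T}.
        op_norm H (fun_calc H f T))"

definition schur_agler_class :: "'a itself \<Rightarrow> (complex ^ 'd::finite \<Rightarrow> complex) set" where
  "schur_agler_class U = {f. analytic_on_polydisc f \<and> agler_norm U f \<le> 1}"

text \<open>
  A type can serve as such a universe if it has at least the cardinality of the continuum, that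
  is, if it has room for some (equivalently, for every separable) nonzero Hilbert space.
\<close>

definition hilbert_universe :: "'a itself \<Rightarrow> bool" where
  "hilbert_universe _ \<longleftrightarrow> (\<exists>g :: complex \<Rightarrow> 'a. inj g)"

end

(* The form p has the matrix A = (1 + s) I - J with J the all-ones matrix, whose eigenvalues 1 + s and
   1 + s - d satisfy |1 + s - d| < 1 + s. Hence for contractions T_i the vectors
   w_i = sum_j A_ij T_j x have square sum at most (1 + s)^2 sum_j |T_j x|^2, and p(T) x = sum_i T_i w_i
   has norm at most (1 + s) d |x|; no adjoints are needed.

   The bound is sharp for operators: let u_1, ..., u_d be the d-th roots of unity, seen as vectors in the
   plane, so that they are unit vectors with sum 0. Let T_i map e to u_i and a vector w of the plane
   to <w, u_i> f, and let it kill f. These are commuting contractions on a space of dimension 4, and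
   p(T) e = ((1 + s) sum_i |u_i|^2 - |sum_i u_i|^2) f = (1 + s) d f.

   In the scalar case equality on the closed polydisc forces sum_m z_m = 0 and all z_m^2 to be equal
   and unimodular, that is z_m = +-z_1, which is possible only for even d. *)

theory Submission
  imports Defs
begin

section \<open>Taylor coefficients of quadratic forms\<close>

text \<open>Convergence at r/2 gives a positive radius of convergence, so the series is a formal
  power series whose evaluation agrees with that of 0 near the origin.\<close>

lemma power_series_zero_imp_coeff_zero:
  fixes g :: "nat \<Rightarrow> complex"
  assumes "r > 0" and "\<And>t. cmod t < r \<Longrightarrow> (\<lambda>n. g n * t ^ n) sums 0"
  shows "g n = 0"
proof -
  have "ereal (norm (of_real (r/2) :: complex)) \<le> conv_radius g"
    using assms by (intro conv_radius_geI sums_summable[OF assms(2)]) auto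
  with \<open>r > 0\<close> have "fps_conv_radius (Abs_fps g) > 0"
    by (auto simp: fps_conv_radius_def intro: less_le_trans[of 0 "ereal (r/2)"])
  moreover have "eventually (\<lambda>z. eval_fps (Abs_fps g) z = eval_fps 0 z) (nhds 0)"
    using assms by (auto simp: eventually_nhds_metric eval_fps_def sums_unique[OF assms(2), symmetric] intro!: exI[of _ r])
  ultimately have "Abs_fps g = 0"
    by (intro eval_fps_eqD) auto
  thus ?thesis
    by (metis fps_nth_Abs_fps fps_zero_nth)
qed

text \<open>Induction on the set S of active variables. With the variables in S fixed, the series is
  a one-variable power series in z_j that vanishes near 0, so each of its coefficients vanishes;
  these coefficients are series in the variables of S, to which the induction hypothesis applies.
  Exponents are functions on the whole type, hence the condition that they vanish outside S.\<close>

lemma multi_power_series_zero_imp_coeff_zero: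
  fixes c :: "('i \<Rightarrow> nat) \<Rightarrow> complex"
  assumes "finite S" "r > 0" 
    and "\<And>z. (\<And>i. cmod (z i) < r) \<Longrightarrow>
          ((\<lambda>\<alpha>. c \<alpha> * (\<Prod>i\<in>S. z i ^ \<alpha> i)) has_sum 0) {\<alpha>. \<forall>i. i \<notin> S \<longrightarrow> \<alpha> i = 0}"
    and "\<And>i. i \<notin> S \<Longrightarrow> \<alpha> i = 0"
  shows "c \<alpha> = 0"
  using assms(1,3,4)
proof (induction S arbitrary: c \<alpha> rule: finite_induct)
  case empty
  have *: "{\<alpha>. \<forall>i. i \<notin> {} \<longrightarrow> \<alpha> i = 0} = {\<alpha>}" "\<alpha> = (\<lambda>_. 0)"
    using empty(2) by auto
  from empty(1)[of "\<lambda>_. 0"] \<open>r > 0\<close> show ?case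
    unfolding * by (simp add: has_sum_finite_iff)
next
  case (insert j S)
  define A where "A = {\<alpha>::'i \<Rightarrow> nat. \<forall>i. i \<notin> S \<longrightarrow> \<alpha> i = 0}"
  \<comment> \<open>Splits an exponent into its entry n at j and the rest, so that the family can be
    summed over n and over A separately.\<close>
  have bij: "bij_betw (\<lambda>(n, \<beta>). \<beta>(j := n)) (UNIV \<times> A) {\<alpha>. \<forall>i. i \<notin> insert j S \<longrightarrow> \<alpha> i = 0}"
    using insert(2)
    by (intro bij_betwI[where g = "\<lambda>\<alpha>. (\<alpha> j, \<alpha>(j := 0))"]) (auto simp: A_def fun_eq_iff)
  have mono: "(\<Prod>i\<in>insert j S. z i ^ (\<beta>(j := n)) i) = z j ^ n * (\<Prod>i\<in>S. z i ^ \<beta> i)" 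
    for z :: "'i \<Rightarrow> complex" and \<beta> n
    using insert(1,2) by (simp add: prod.insert) (intro disjI2 prod.cong, auto)
  have sum_pair: "((\<lambda>(n, \<beta>). c (\<beta>(j := n)) * (z j ^ n * (\<Prod>i\<in>S. z i ^ \<beta> i))) has_sum 0) (UNIV \<times> A)"
    if "\<And>i. cmod (z i) < r" for z
    using insert.prems(1)[of z, OF that] unfolding has_sum_reindex_bij_betw[OF bij, symmetric]
    by (simp only: mono case_prod_unfold)
  have slice: "((\<lambda>\<beta>. c (\<beta>(j := n)) * (\<Prod>i\<in>S. z i ^ \<beta> i)) has_sum 0) A"
    if z: "\<And>i. cmod (z i) < r" for z n
  proof -
    define z' where "z' t = z(j := t)" for t
    have z': "cmod (z' t i) < r" if "cmod t < r" for t i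
      using z that by (auto simp: z'_def)
    have pz': "(\<Prod>i\<in>S. z' t i ^ \<beta> i) = (\<Prod>i\<in>S. z i ^ \<beta> i)" for t \<beta>
      using insert(2) by (intro prod.cong) (auto simp: z'_def)
    have all: "((\<lambda>(n, \<beta>). t ^ n * (c (\<beta>(j := n)) * (\<Prod>i\<in>S. z i ^ \<beta> i))) has_sum 0) (UNIV \<times> A)"
      if "cmod t < r" for t
      using sum_pair[of "z' t", OF z', OF that] by (simp add: pz') (simp add: z'_def mult_ac)
    \<comment> \<open>At the nonzero value t = r/2 the factor t ^ n can be cancelled, which leaves
      summability of the n-th slice itself.\<close>
    have sm: "(\<lambda>\<beta>. c (\<beta>(j := n)) * (\<Prod>i\<in>S. z i ^ \<beta> i)) summable_on A" for n
    proof -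
      have "(\<lambda>\<beta>. complex_of_real (r/2) ^ n * (c (\<beta>(j := n)) * (\<Prod>i\<in>S. z i ^ \<beta> i))) summable_on A"
        using summable_on_SigmaD1[OF has_sum_imp_summable[OF all[of "of_real (r/2)"]], of n] \<open>r > 0\<close>
        by simp
      thus ?thesis
        using \<open>r > 0\<close> by (subst (asm) summable_on_cmult_right') auto
    qed
    define g where "g n = infsum (\<lambda>\<beta>. c (\<beta>(j := n)) * (\<Prod>i\<in>S. z i ^ \<beta> i)) A" for n
    have g: "((\<lambda>\<beta>. c (\<beta>(j := n)) * (\<Prod>i\<in>S. z i ^ \<beta> i)) has_sum g n) A" for n
      unfolding g_def using sm by (rule has_sum_infsum)
    have "g n = 0"
    proof (rule power_series_zero_imp_coeff_zero[OF \<open>r > 0\<close>])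
      fix t :: complex assume t: "cmod t < r"
      have "((\<lambda>n. t ^ n * g n) has_sum 0) UNIV"
        by (rule has_sum_SigmaD[OF all[OF t]]) (simp add: has_sum_cmult_right g)
      thus "(\<lambda>n. g n * t ^ n) sums 0"
        by (intro has_sum_imp_sums) (simp add: mult.commute)
    qed
    thus ?thesis using g[of n] by simp
  qed
  have "c ((\<alpha>(j := 0))(j := \<alpha> j)) = 0"
    using insert.prems(2)
    by (intro insert.IH[of "\<lambda>\<beta>. c (\<beta>(j := \<alpha> j))"] slice[unfolded A_def]) auto
  thus ?case by simp
qed

text \<open>The difference of the two series vanishes on the smaller polydisc. Uniqueness is what
  allows the definite description in \<open>taylor_coeff\<close> to be evaluated.\<close>

lemma has_power_series_unique:
  assumes "has_power_series f a c" "has_power_series f a c'"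
  shows "c = c'"
proof
  fix \<alpha> :: "'a \<Rightarrow> nat"
  obtain r1 r2 where r: "r1 > 0" "r2 > 0"
    and s1: "\<And>z. (\<forall>i. cmod (z $ i - a $ i) < r1) \<Longrightarrow>
        ((\<lambda>\<alpha>. c \<alpha> * (\<Prod>i\<in>UNIV. (z $ i - a $ i) ^ \<alpha> i)) has_sum f z) UNIV"
    and s2: "\<And>z. (\<forall>i. cmod (z $ i - a $ i) < r2) \<Longrightarrow>
        ((\<lambda>\<alpha>. c' \<alpha> * (\<Prod>i\<in>UNIV. (z $ i - a $ i) ^ \<alpha> i)) has_sum f z) UNIV"
    using assms unfolding has_power_series_def by blast
  have "c \<alpha> - c' \<alpha> = 0"
  proof (rule multi_power_series_zero_imp_coeff_zero[of UNIV "min r1 r2" "\<lambda>\<alpha>. c \<alpha> - c' \<alpha>"])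
    fix z :: "'a \<Rightarrow> complex" assume z: "\<And>i. cmod (z i) < min r1 r2"
    define w where "w = (\<chi> i. a $ i + z i)"
    have "((\<lambda>\<alpha>. c \<alpha> * (\<Prod>i\<in>UNIV. z i ^ \<alpha> i)) has_sum f w) UNIV"
      "((\<lambda>\<alpha>. c' \<alpha> * (\<Prod>i\<in>UNIV. z i ^ \<alpha> i)) has_sum f w) UNIV"
      using s1[of w] s2[of w] z by (auto simp: w_def)
    from has_sum_add[OF this(1) has_sum_uminusI[OF this(2)]]
    show "((\<lambda>\<alpha>. (c \<alpha> - c' \<alpha>) * (\<Prod>i\<in>UNIV. z i ^ \<alpha> i)) has_sum 0) {\<alpha>. \<forall>i. i \<notin> UNIV \<longrightarrow> \<alpha> i = 0}"
      by (simp add: algebra_simps)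
  qed (use r in auto)
  thus "c \<alpha> = c' \<alpha>" by simp
qed

section \<open>Quadratic forms as power series with finite support\<close>

definition incr :: "'i \<Rightarrow> ('i \<Rightarrow> nat) \<Rightarrow> 'i \<Rightarrow> nat" where
  "incr i \<alpha> = \<alpha>(i := Suc (\<alpha> i))"

definition pair_index :: "'i \<Rightarrow> 'i \<Rightarrow> 'i \<Rightarrow> nat" where
  "pair_index i j = incr i (incr j (\<lambda>_. 0))"

text \<open>The scalar half of a recursion along \<open>incr\<close>; its operator half is
  \<open>op_monomial_incr\<close>. Both reduce the monomial of \<open>pair_index i j\<close> to a
  product of two factors.\<close>

lemma prod_power_incr:
  fixes z :: "'i::finite \<Rightarrow> complex"
  shows "(\<Prod>k\<in>UNIV. z k ^ incr i \<alpha> k) = z i * (\<Prod>k\<in>UNIV. z k ^ \<alpha> k)"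
proof -
  have "(\<Prod>k\<in>UNIV. z k ^ incr i \<alpha> k) = (\<Prod>k\<in>UNIV. (if k = i then z k else 1) * z k ^ \<alpha> k)"
    by (intro prod.cong) (auto simp: incr_def)
  thus ?thesis by (simp add: prod.distrib)
qed

text \<open>
  The pairs $(i, j)$ and $(j, i)$ have the same exponent, so for $i \<noteq> j$ the coefficient is
  $a_{ij} + a_{ji}$.
\<close>

definition quad_coeff :: "('i::finite \<Rightarrow> 'i \<Rightarrow> complex) \<Rightarrow> ('i \<Rightarrow> nat) \<Rightarrow> complex" where
  "quad_coeff a \<alpha> = (\<Sum>i\<in>UNIV. \<Sum>j\<in>UNIV. if \<alpha> = pair_index i j then a i j else 0)"

definition quad_support :: "('i::finite \<Rightarrow> nat) set" where
  "quad_support = range (\<lambda>(i, j). pair_index i j)"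

lemma finite_quad_support: "finite quad_support"
  by (simp add: quad_support_def)

lemma quad_coeff_outside: "\<alpha> \<notin> quad_support \<Longrightarrow> quad_coeff a \<alpha> = 0"
  unfolding quad_coeff_def quad_support_def by (intro sum.neutral ballI) auto

text \<open>The function g is kept arbitrary because the identity is used twice: with the scalar
  monomials, and with the inner products of T^\<alpha> x against a fixed vector.\<close>

lemma sum_quad_coeff:
  "(\<Sum>\<alpha>\<in>quad_support. quad_coeff a \<alpha> * g \<alpha>) = (\<Sum>i\<in>UNIV. \<Sum>j\<in>UNIV. a i j * g (pair_index i j))"
proof -
  have "(\<Sum>\<alpha>\<in>quad_support. quad_coeff a \<alpha> * g \<alpha>)
     = (\<Sum>\<alpha>\<in>quad_support. \<Sum>i\<in>UNIV. \<Sum>j\<in>UNIV. if \<alpha> = pair_index i j then a i j * g \<alpha> else 0)"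
    by (auto simp: quad_coeff_def sum_distrib_right intro!: sum.cong)
  also have "\<dots> = (\<Sum>i\<in>UNIV. \<Sum>j\<in>UNIV. \<Sum>\<alpha>\<in>quad_support. if \<alpha> = pair_index i j then a i j * g \<alpha> else 0)"
    by (subst sum.swap, intro sum.cong refl) (rule sum.swap)
  also have "\<dots> = (\<Sum>i\<in>UNIV. \<Sum>j\<in>UNIV. a i j * g (pair_index i j))"
    by (intro sum.cong refl) (auto simp: sum.delta[OF finite_quad_support] quad_support_def)
  finally show ?thesis .
qed

lemma taylor_coeff_quadratic:
  fixes f :: "complex ^ 'd::finite \<Rightarrow> complex"
  assumes f: "\<And>z. f z = (\<Sum>i\<in>UNIV. \<Sum>j\<in>UNIV. a i j * (z $ i * z $ j))"
  shows "taylor_coeff f = quad_coeff a"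
proof -
  have "has_power_series f 0 (quad_coeff a)"
    unfolding has_power_series_def
  \<comment> \<open>The series is a finite sum equal to f everywhere, so any radius would
    do.\<close>
  proof (intro exI[of _ 1] conjI allI impI)
    fix z :: "complex ^ 'd"
    have "f z = (\<Sum>\<alpha>\<in>quad_support. quad_coeff a \<alpha> * (\<Prod>i\<in>UNIV. (z $ i) ^ \<alpha> i))"
      by (simp add: sum_quad_coeff f pair_index_def prod_power_incr)
    thus "((\<lambda>\<alpha>. quad_coeff a \<alpha> * (\<Prod>i\<in>UNIV. (z $ i - 0 $ i) ^ \<alpha> i)) has_sum f z) UNIV"
      by (intro has_sum_finite_neutralI[OF finite_quad_support]) (auto simp: quad_coeff_outside)
  qed auto
  thus ?thesis
    unfolding taylor_coeff_def by (blast intro: the_equality has_power_series_unique)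
qed

section \<open>Hilbert spaces with a carrier\<close>

context complex_hilbert_space
begin

lemma smult_in_carrier [simp, intro]: "x \<in> carrier H \<Longrightarrow> a \<odot> x \<in> carrier H"
  by (rule smult_closed) (auto simp: ring_of_type_algebra_def)

lemma ip_zero_left [simp]: "z \<in> carrier H \<Longrightarrow> ip H \<zero> z = 0"
  using ip_add_left[of \<zero> \<zero> z] by simp

lemma minus_add_cancel:
  assumes "x \<in> carrier H" "y \<in> carrier H"
  shows "(x \<ominus> y) \<oplus> y = x"
  using assms by (simp add: a_minus_def a_assoc l_neg)

lemma ip_diff_left:
  assumes "x \<in> carrier H" "y \<in> carrier H" "z \<in> carrier H"
  shows "ip H (x \<ominus> y) z = ip H x z - ip H y z"
  using ip_add_left[of "x \<ominus> y" y z] assms by (simp add: minus_add_cancel)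

lemma ip_finsum_left:
  assumes "finite A" "f \<in> A \<rightarrow> carrier H" "z \<in> carrier H"
  shows "ip H (\<Oplus>i\<in>A. f i) z = (\<Sum>i\<in>A. ip H (f i) z)"
  using assms by (induction A rule: finite_induct) (auto simp: finsum_insert ip_add_left finsum_closed)

lemma ip_zero_right [simp]: "z \<in> carrier H \<Longrightarrow> ip H z \<zero> = 0"
  using ip_commute[of \<zero> z] by simp

lemma ip_add_right:
  assumes "x \<in> carrier H" "y \<in> carrier H" "z \<in> carrier H"
  shows "ip H z (x \<oplus> y) = ip H z x + ip H z y"
  using assms ip_add_left[of x y z] by (simp add: ip_commute[of _ z])

lemma ip_diff_right:
  assumes "x \<in> carrier H" "y \<in> carrier H" "z \<in> carrier H"
  shows "ip H z (x \<ominus> y) = ip H z x - ip H z y"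
  using assms ip_diff_left[of x y z] by (simp add: ip_commute[of _ z])

lemma ip_smult_right:
  assumes "x \<in> carrier H" "z \<in> carrier H"
  shows "ip H z (a \<odot> x) = cnj a * ip H z x"
  using assms ip_smult_left[of x z a] by (simp add: ip_commute[of _ z])

lemma Im_ip_self: "x \<in> carrier H \<Longrightarrow> Im (ip H x x) = 0"
  using ip_commute[of x x] by (simp add: complex_eq_iff)

lemma Re_ip_self_nonneg: "x \<in> carrier H \<Longrightarrow> Re (ip H x x) \<ge> 0"
  using ip_pos[of x] by (cases "x = \<zero>") auto

lemma hnorm_nonneg [simp]: "x \<in> carrier H \<Longrightarrow> hnorm H x \<ge> 0"
  by (simp add: hnorm_def Re_ip_self_nonneg)

lemma ip_self: "x \<in> carrier H \<Longrightarrow> ip H x x = of_real ((hnorm H x)\<^sup>2)"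
  by (simp add: hnorm_def Re_ip_self_nonneg complex_eq_iff Im_ip_self)

lemma hnorm_eq_0_iff [simp]: "x \<in> carrier H \<Longrightarrow> hnorm H x = 0 \<longleftrightarrow> x = \<zero>"
  using ip_pos[of x] by (cases "x = \<zero>") (auto simp: hnorm_def)

text \<open>Testing with z = x - y suffices. Vector identities are thereby reduced to identities
  between complex numbers, which avoids calculating in the abelian group of the carrier.\<close>

lemma eqI_ip:
  assumes "x \<in> carrier H" "y \<in> carrier H" "\<And>z. z \<in> carrier H \<Longrightarrow> ip H x z = ip H y z"
  shows "x = y"
proof -
  have "ip H (x \<ominus> y) (x \<ominus> y) = 0"
    using assms by (simp add: ip_diff_left)
  hence "x \<ominus> y = \<zero>"
    using assms ip_pos[of "x \<ominus> y"] by fastforce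
  thus ?thesis
    using assms(1,2) minus_add_cancel[of x y] by simp
qed

lemma hnorm_zero [simp]: "hnorm H \<zero> = 0"
  by (simp add: hnorm_def)

lemma hnorm_smult:
  assumes "x \<in> carrier H"
  shows "hnorm H (a \<odot> x) = cmod a * hnorm H x"
proof -
  have "ip H (a \<odot> x) (a \<odot> x) = (a * cnj a) * ip H x x"
    using assms by (simp add: ip_smult_left ip_smult_right)
  hence "Re (ip H (a \<odot> x) (a \<odot> x)) = (cmod a)\<^sup>2 * Re (ip H x x)"
    by (simp add: complex_norm_square[symmetric] Re_complex_of_real[of "_ ^ 2", unfolded of_real_power])
  thus ?thesis
    by (simp add: hnorm_def real_sqrt_mult)
qed

lemma Cauchy_Schwarz:
  assumes "x \<in> carrier H" "y \<in> carrier H"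
  shows "cmod (ip H x y) \<le> hnorm H x * hnorm H y"
proof (cases "y = \<zero>")
  case True
  thus ?thesis using assms ip_commute[of \<zero> x] by simp
next
  case False
  \<comment> \<open>c y is the orthogonal projection of x onto the line of y. The remainder u is
    orthogonal to y, and the inequality is the nonnegativity of |u|^2 = |x|^2 - |<x,y>|^2 /
    |y|^2.\<close>
  define c where "c = ip H x y / of_real ((hnorm H y)\<^sup>2)"
  define u where "u = x \<ominus> (c \<odot> y)"
  have y: "hnorm H y > 0" using assms False hnorm_nonneg[of y] hnorm_eq_0_iff[of y] by linarith
  have u: "u \<in> carrier H" using assms by (simp add: u_def)
  have "ip H u y = 0"
    using assms y by (simp add: u_def ip_diff_left ip_smult_left ip_self c_def del: of_real_power)
  hence "ip H u u = ip H u x"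
    using assms u by (subst (2) u_def) (simp add: ip_diff_right ip_smult_right)
  also have "\<dots> = of_real ((hnorm H x)\<^sup>2) - c * cnj (ip H x y)"
    using assms by (simp add: u_def ip_diff_left ip_smult_left ip_self ip_commute[of x y])
  also have "c * cnj (ip H x y) = of_real ((cmod (ip H x y))\<^sup>2 / (hnorm H y)\<^sup>2)"
    unfolding c_def of_real_divide complex_norm_square by simp
  finally have "(hnorm H u)\<^sup>2 = (hnorm H x)\<^sup>2 - (cmod (ip H x y))\<^sup>2 / (hnorm H y)\<^sup>2"
    using u by (simp only: ip_self flip: of_real_diff) (simp only: of_real_eq_iff)
  hence "(cmod (ip H x y))\<^sup>2 / (hnorm H y)\<^sup>2 \<le> (hnorm H x)\<^sup>2"
    by (smt (verit) zero_le_power2)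
  hence "(cmod (ip H x y))\<^sup>2 \<le> (hnorm H x * hnorm H y)\<^sup>2"
    using y by (simp add: divide_simps power_mult_distrib)
  thus ?thesis
    using assms by (intro power2_le_imp_le[of "cmod (ip H x y)"]) auto
qed

lemma hnorm_add_le:
  assumes "x \<in> carrier H" "y \<in> carrier H"
  shows "hnorm H (x \<oplus> y) \<le> hnorm H x + hnorm H y"
proof -
  have "complex_of_real ((hnorm H (x \<oplus> y))\<^sup>2) =
      of_real ((hnorm H x)\<^sup>2) + of_real ((hnorm H y)\<^sup>2) + (ip H x y + cnj (ip H x y))"
    using assms by (simp only: ip_self[symmetric] a_closed)
      (simp add: ip_add_left ip_add_right ip_commute[of x y])
  also have "\<dots> = of_real ((hnorm H x)\<^sup>2 + (hnorm H y)\<^sup>2 + 2 * Re (ip H x y))"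
    by (simp add: complex_eq_iff)
  finally have "(hnorm H (x \<oplus> y))\<^sup>2 = (hnorm H x)\<^sup>2 + (hnorm H y)\<^sup>2 + 2 * Re (ip H x y)"
    by (simp only: of_real_eq_iff)
  also have "\<dots> \<le> (hnorm H x + hnorm H y)\<^sup>2"
    using Cauchy_Schwarz[OF assms] complex_Re_le_cmod[of "ip H x y"]
    by (simp add: power2_sum)
  finally show ?thesis
    by (rule power2_le_imp_le) (use assms in auto)
qed

lemma hnorm_finsum_le:
  assumes "finite A" "f \<in> A \<rightarrow> carrier H"
  shows "hnorm H (\<Oplus>i\<in>A. f i) \<le> (\<Sum>i\<in>A. hnorm H (f i))"
  using assms
proof (induction A rule: finite_induct)
  case (insert i A)
  thus ?case
    using hnorm_add_le[of "f i" "\<Oplus>i\<in>A. f i"] by (simp add: finsum_insert finsum_closed Pi_iff)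
qed simp

lemma hnorm_minus_commute:
  assumes "x \<in> carrier H" "y \<in> carrier H"
  shows "hnorm H (x \<ominus> y) = hnorm H (y \<ominus> x)"
  unfolding hnorm_def using assms by (simp add: ip_diff_left ip_diff_right)

lemma Metric_space_hdist: "Metric_space (carrier H) (hdist H)"
proof
  fix x y z assume "x \<in> carrier H" "y \<in> carrier H" "z \<in> carrier H"
  moreover from this have "x \<ominus> z = (x \<ominus> y) \<oplus> (y \<ominus> z)"
    by (intro eqI_ip) (auto simp: ip_add_left ip_diff_left)
  ultimately show "hdist H x z \<le> hdist H x y + hdist H y z"
    using hnorm_add_le[of "x \<ominus> y" "y \<ominus> z"] by (simp add: hdist_def)
next
  fix x y assume xy: "x \<in> carrier H" "y \<in> carrier H"
  have "x \<ominus> y = \<zero> \<longleftrightarrow> x = y"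
    using minus_add_cancel[OF xy] xy by (auto simp: a_minus_def r_neg)
  thus "hdist H x y = 0 \<longleftrightarrow> x = y"
    using xy by (simp add: hdist_def)
qed (auto simp: hdist_def hnorm_minus_commute)

lemma linear_operator_zero:
  assumes "linear_operator H A"
  shows "A \<zero> = \<zero>"
proof -
  have "A \<zero> \<in> carrier H" "A (\<zero> \<oplus> \<zero>) = A \<zero> \<oplus> A \<zero>"
    using assms zero_closed unfolding linear_operator_def by blast+
  thus ?thesis
    using ip_add_left[of "A \<zero>" "A \<zero>"] by (intro eqI_ip) auto
qed

text \<open>\<open>op_norm\<close> is a supremum over the unit ball only; the bound at a nonzero x
  follows by homogeneity from the bound at x / |x|.\<close>

lemma contraction_bound:
  assumes A: "linear_operator H A" and "op_norm H A \<le> 1" and x: "x \<in> carrier H"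
  shows "hnorm H (A x) \<le> hnorm H x"
proof (cases "x = \<zero>")
  case False
  hence pos: "hnorm H x > 0"
    using x hnorm_nonneg[of x] hnorm_eq_0_iff[of x] by linarith
  have Ax: "A x \<in> carrier H" using A x by (auto simp: linear_operator_def)
  let ?u = "complex_of_real (1 / hnorm H x) \<odot> x"
  have u: "?u \<in> carrier H" "hnorm H ?u \<le> 1"
    using x pos by (auto simp: hnorm_smult simp del: of_real_divide)
  have "ereal (hnorm H (A ?u)) \<le> op_norm H A"
    unfolding op_norm_def using u by (intro SUP_upper) auto
  also note \<open>op_norm H A \<le> 1\<close>
  finally have "hnorm H (A ?u) \<le> 1" by simp
  also have "A ?u = complex_of_real (1 / hnorm H x) \<odot> A x"
    using A x by (simp add: linear_operator_def)
  finally show ?thesis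
    using Ax pos by (simp add: hnorm_smult field_simps del: of_real_divide)
qed (use linear_operator_zero[OF A] in simp)

end

lemma op_norm_leI:
  assumes "\<And>x. x \<in> carrier H \<Longrightarrow> hnorm H x \<le> 1 \<Longrightarrow> hnorm H (A x) \<le> b"
  shows "op_norm H A \<le> ereal b"
  unfolding op_norm_def using assms by (intro SUP_least) auto

section \<open>Quadratic forms in commuting contractions\<close>

context
  fixes H :: "'a hilbert" and T :: "'d::finite \<Rightarrow> 'a \<Rightarrow> 'a"
  assumes T: "commuting_strict_contractions H T"
begin

lemma operator_in_carrier: "x \<in> carrier H \<Longrightarrow> T i x \<in> carrier H"
  using T by (auto simp: commuting_strict_contractions_def linear_operator_def)

lemma operator_power_in_carrier: "x \<in> carrier H \<Longrightarrow> (T i ^^ n) x \<in> carrier H"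
  by (induction n) (auto simp: operator_in_carrier)

lemma operator_power_commute: "x \<in> carrier H \<Longrightarrow> (T i ^^ n) (T j x) = T j ((T i ^^ n) x)"
proof (induction n)
  case (Suc n)
  thus ?case using T operator_power_in_carrier[of x n i]
    by (auto simp: commuting_strict_contractions_def)
qed simp

text \<open>The additional factor T_i arises at the place of i in the product, which is unique by
  distinctness, and is moved to the front past the powers before it. Commutation is assumed on the
  carrier only, so membership in the carrier is carried through the same induction.\<close>

lemma foldr_operator_incr:
  assumes "distinct is" "x \<in> carrier H"
  shows "foldr (\<lambda>k A. (T k ^^ \<alpha> k) \<circ> A) is id x \<in> carrier H \<and>
    foldr (\<lambda>k A. (T k ^^ incr i \<alpha> k) \<circ> A) is id x =
      (if i \<in> set is then T i else id) (foldr (\<lambda>k A. (T k ^^ \<alpha> k) \<circ> A) is id x)"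
  using assms
  by (induction "is") (auto simp: operator_power_in_carrier operator_power_commute incr_def)

lemma op_monomial_incr:
  assumes "x \<in> carrier H"
  shows "op_monomial T \<alpha> x \<in> carrier H" "op_monomial T (incr i \<alpha>) x = T i (op_monomial T \<alpha> x)"
proof -
  define ks where "ks = (SOME ks::'d list. distinct ks \<and> set ks = UNIV)"
  have "\<exists>ks::'d list. distinct ks \<and> set ks = UNIV"
    using finite_distinct_list[of "UNIV :: 'd set"] by auto
  hence "distinct ks \<and> set ks = UNIV"
    unfolding ks_def by (rule someI_ex)
  with foldr_operator_incr[of ks x \<alpha> i] assms
  show "op_monomial T \<alpha> x \<in> carrier H" "op_monomial T (incr i \<alpha>) x = T i (op_monomial T \<alpha> x)"
    unfolding op_monomial_def ks_def[symmetric] by auto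
qed

lemma op_monomial_zero: "op_monomial T (\<lambda>_. 0) x = x"
proof -
  have "foldr (\<lambda>k A. (T k ^^ 0) \<circ> A) ks id x = x" for ks :: "'d list"
    by (induction ks) auto
  thus ?thesis by (simp add: op_monomial_def)
qed

lemma op_monomial_pair_index:
  "x \<in> carrier H \<Longrightarrow> op_monomial T (pair_index i j) x = T i (T j x)"
  by (simp add: pair_index_def op_monomial_incr op_monomial_zero)

text \<open>The partial sums are constant as soon as F contains the finite support of the
  coefficients, so the net converges to that constant, and uniqueness of limits evaluates the
  definite description. The value is described by its inner products, in the form that
  \<open>eqI_ip\<close> asks for.\<close>

lemma fun_calc_quadratic:
  fixes f :: "complex ^ 'd \<Rightarrow> complex"
  assumes H: "complex_hilbert_space H"
    and f: "\<And>z. f z = (\<Sum>i\<in>UNIV. \<Sum>j\<in>UNIV. a i j * (z $ i * z $ j))"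
    and x: "x \<in> carrier H"
  shows "fun_calc H f T x \<in> carrier H"
    and "z \<in> carrier H \<Longrightarrow>
      ip H (fun_calc H f T x) z = (\<Sum>i\<in>UNIV. \<Sum>j\<in>UNIV. a i j * ip H (T i (T j x)) z)"
proof -
  interpret complex_hilbert_space H by fact
  interpret MS: Metric_space "carrier H" "hdist H" by (rule Metric_space_hdist)
  define S where "S F = (\<Oplus>\<^bsub>H\<^esub>\<alpha>\<in>F. taylor_coeff f \<alpha> \<odot>\<^bsub>H\<^esub> op_monomial T \<alpha> x)" for F
  have tc: "taylor_coeff f = quad_coeff a"
    using f by (rule taylor_coeff_quadratic)
  have S_carrier: "S F \<in> carrier H" for F
    unfolding S_def using x by (intro finsum_closed) (auto simp: op_monomial_incr)
  have ip_S: "ip H (S F) z = (\<Sum>i\<in>UNIV. \<Sum>j\<in>UNIV. a i j * ip H (T i (T j x)) z)"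
    if "finite F" "quad_support \<subseteq> F" "z \<in> carrier H" for F z
  proof -
    have "ip H (S F) z = (\<Sum>\<alpha>\<in>F. quad_coeff a \<alpha> * ip H (op_monomial T \<alpha> x) z)"
      unfolding S_def using that x
      by (subst ip_finsum_left) (auto simp: op_monomial_incr ip_smult_left tc)
    also have "\<dots> = (\<Sum>\<alpha>\<in>quad_support. quad_coeff a \<alpha> * ip H (op_monomial T \<alpha> x) z)"
      using that by (intro sum.mono_neutral_right) (auto simp: quad_coeff_outside)
    finally show ?thesis
      using x by (simp add: sum_quad_coeff op_monomial_pair_index)
  qed
  have const: "S F = S quad_support" if "finite F" "quad_support \<subseteq> F" for F
    using that by (intro eqI_ip S_carrier) (simp add: ip_S finite_quad_support)
  have lim: "limitin MS.mtopology S (S quad_support) (finite_subsets_at_top UNIV)"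
    unfolding MS.limitin_metric
  proof (intro conjI allI impI)
    fix e :: real assume "e > 0"
    have "eventually (\<lambda>F. finite F \<and> quad_support \<subseteq> F)
        (finite_subsets_at_top (UNIV :: ('d \<Rightarrow> nat) set))"
      unfolding eventually_finite_subsets_at_top using finite_quad_support by blast
    thus "eventually (\<lambda>F. S F \<in> carrier H \<and> hdist H (S F) (S quad_support) < e)
        (finite_subsets_at_top UNIV)"
    proof eventually_elim
      case (elim F)
      hence "S F = S quad_support" using const by blast
      thus ?case using \<open>e > 0\<close> S_carrier by simp
    qed
  qed (rule S_carrier)
  have "fun_calc H f T x = S quad_support"
    unfolding fun_calc_def S_def[symmetric]
    by (rule the_equality, rule lim) (rule MS.limitin_metric_unique[OF _ lim], simp_all)
  thus "fun_calc H f T x \<in> carrier H"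
    and "z \<in> carrier H \<Longrightarrow>
      ip H (fun_calc H f T x) z = (\<Sum>i\<in>UNIV. \<Sum>j\<in>UNIV. a i j * ip H (T i (T j x)) z)"
    using S_carrier ip_S finite_quad_support by auto
qed

end

text \<open>The coefficients are the entries of \<kappa> (c I - J). The array g i j is z_i z_j for
  scalars and <T_i T_j x, z> for operators; the factor \<kappa> makes room for the normalised
  form.\<close>

lemma sum_weighted_form:
  fixes g :: "'i::finite \<Rightarrow> 'i \<Rightarrow> complex"
  shows "(\<Sum>i\<in>UNIV. \<Sum>j\<in>UNIV. \<kappa> * ((if i = j then c else 0) - 1) * g i j) =
    \<kappa> * (c * (\<Sum>i\<in>UNIV. g i i) - (\<Sum>i\<in>UNIV. \<Sum>j\<in>UNIV. g i j))"
proof -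
  have "(\<Sum>j\<in>UNIV. \<kappa> * ((if i = j then c else 0) - 1) * g i j)
      = \<kappa> * (c * g i i - (\<Sum>j\<in>UNIV. g i j))" for i
  proof -
    have "(\<Sum>j\<in>UNIV. \<kappa> * ((if i = j then c else 0) - 1) * g i j)
        = (\<Sum>j\<in>UNIV. (if i = j then \<kappa> * c * g i j else 0) - \<kappa> * g i j)"
      by (intro sum.cong) (auto simp: algebra_simps)
    thus ?thesis
      by (simp add: sum_subtractf sum_distrib_left algebra_simps)
  qed
  thus ?thesis
    by (simp add: sum_subtractf sum_distrib_left[symmetric])
qed

section \<open>The upper bound for commuting contractions\<close>

context complex_hilbert_space
begin

text \<open>The bound c for the norm of c I - J, without spectral theory: since the v_i sum to S,
  expanding the squares gives c^2 sum |v_i|^2 - (2c - d) |S|^2, and 2c - d is nonnegative.\<close>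

lemma sum_hnorm_scaled_minus_sum_le:
  fixes v :: "'d::finite \<Rightarrow> 'a" and c :: real
  assumes v: "\<And>i. v i \<in> carrier H" and c: "real CARD('d) \<le> 2 * c"
  defines "S \<equiv> \<Oplus>i\<in>UNIV. v i"
  shows "(\<Sum>i\<in>UNIV. (hnorm H ((of_real c \<odot> v i) \<ominus> S))\<^sup>2) \<le> c\<^sup>2 * (\<Sum>i\<in>UNIV. (hnorm H (v i))\<^sup>2)"
proof -
  have S: "S \<in> carrier H" using v by (simp add: S_def finsum_closed)
  have sum_S: "(\<Sum>i\<in>UNIV. ip H (v i) S) = ip H S S"
    using ip_finsum_left[of UNIV v S] v S by (simp add: S_def[symmetric] Pi_iff)
  have sq: "(hnorm H x)\<^sup>2 = Re (ip H x x)" if "x \<in> carrier H" for x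
    using that by (simp add: ip_self)
  have "(\<Sum>i\<in>UNIV. (hnorm H ((of_real c \<odot> v i) \<ominus> S))\<^sup>2)
      = (\<Sum>i\<in>UNIV. c\<^sup>2 * (hnorm H (v i))\<^sup>2 - 2 * c * Re (ip H (v i) S) + (hnorm H S)\<^sup>2)"
  proof (intro sum.cong refl)
    fix i
    show "(hnorm H ((of_real c \<odot> v i) \<ominus> S))\<^sup>2
        = c\<^sup>2 * (hnorm H (v i))\<^sup>2 - 2 * c * Re (ip H (v i) S) + (hnorm H S)\<^sup>2"
    proof -
      have "(of_real c \<odot> v i) \<ominus> S \<in> carrier H" using v S by simp
      from sq[OF this] sq[OF v[of i]] sq[OF S] v[of i] S ip_commute[of "v i" S] show ?thesis
        by (simp add: ip_diff_left ip_diff_right ip_smult_left ip_smult_right power2_eq_square[of c]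
            algebra_simps)
    qed
  qed
  also have "\<dots> = c\<^sup>2 * (\<Sum>i\<in>UNIV. (hnorm H (v i))\<^sup>2) - 2 * c * Re (\<Sum>i\<in>UNIV. ip H (v i) S)
      + real CARD('d) * (hnorm H S)\<^sup>2"
    by (simp add: sum.distrib sum_subtractf sum_distrib_left)
  also have "\<dots> = c\<^sup>2 * (\<Sum>i\<in>UNIV. (hnorm H (v i))\<^sup>2) - (2 * c - real CARD('d)) * (hnorm H S)\<^sup>2"
    unfolding sum_S using S by (simp add: sq algebra_simps)
  finally show ?thesis using c by simp
qed

end

lemma agler_norm_le:
  fixes f :: "complex ^ 'd::finite \<Rightarrow> complex" and c :: real
  assumes c: "real CARD('d) \<le> 2 * c"
    and f: "\<And>z. f z = of_real c * (\<Sum>m\<in>UNIV. (z $ m)\<^sup>2) - (\<Sum>m\<in>UNIV. z $ m)\<^sup>2"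
  shows "agler_norm TYPE('a) f \<le> ereal (c * real CARD('d))"
  unfolding agler_norm_def
proof (rule SUP_least, clarify, rule op_norm_leI)
  fix H :: "'a hilbert" and T :: "'d \<Rightarrow> 'a \<Rightarrow> 'a" and x
  assume H: "complex_hilbert_space H" and T: "commuting_strict_contractions H T"
    and x: "x \<in> carrier H" "hnorm H x \<le> 1"
  interpret complex_hilbert_space H by fact
  have lin: "linear_operator H (T i)" and contr: "op_norm H (T i) \<le> 1" for i
    using T unfolding commuting_strict_contractions_def by (auto intro: less_imp_le)
  have Tc: "y \<in> carrier H \<Longrightarrow> T i y \<in> carrier H" for i y
    using operator_in_carrier[OF T] .
  define a :: "'d \<Rightarrow> 'd \<Rightarrow> complex" where "a i j = 1 * ((if i = j then of_real c else 0) - 1)" for i j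
  have fq: "f z = (\<Sum>i\<in>UNIV. \<Sum>j\<in>UNIV. a i j * (z $ i * z $ j))" for z
    unfolding f a_def sum_weighted_form by (simp add: power2_eq_square sum_product)
  note fc = fun_calc_quadratic[OF T H fq x(1)]
  define S where "S = (\<Oplus>\<^bsub>H\<^esub>j\<in>UNIV. T j x)"
  define w where "w i = (of_real c \<odot>\<^bsub>H\<^esub> T i x) \<ominus>\<^bsub>H\<^esub> S" for i
  have S: "S \<in> carrier H" using x Tc by (simp add: S_def finsum_closed)
  have w: "w i \<in> carrier H" for i using x Tc S by (simp add: w_def)
  have T_add: "T i (y \<oplus>\<^bsub>H\<^esub> z) = T i y \<oplus>\<^bsub>H\<^esub> T i z" 
    and T_smult: "T i (b \<odot>\<^bsub>H\<^esub> y) = b \<odot>\<^bsub>H\<^esub> T i y" 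
    if "y \<in> carrier H" "z \<in> carrier H" for i b y z
    using lin[of i] that by (auto simp: linear_operator_def)
  have T_sum: "T i (\<Oplus>\<^bsub>H\<^esub>j\<in>B. T j x) = (\<Oplus>\<^bsub>H\<^esub>j\<in>B. T i (T j x))" if "finite B" for i and B :: "'d set"
    using that
  proof (induction B rule: finite_induct)
    case (insert j B)
    thus ?case using x(1) Tc by (simp add: finsum_insert finsum_closed T_add Pi_iff)
  qed (use linear_operator_zero[OF lin] in simp)
  have ip_Tw: "ip H (T i (w i)) z = of_real c * ip H (T i (T i x)) z - (\<Sum>j\<in>UNIV. ip H (T i (T j x)) z)"
    if z: "z \<in> carrier H" for i z
  proof -
    \<comment> \<open>\<open>linear_operator\<close> speaks of sums and scalar multiples, so the
      difference w_i is handled through w_i + S = c T_i x.\<close>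
    have "T i (w i) \<oplus>\<^bsub>H\<^esub> T i S = of_real c \<odot>\<^bsub>H\<^esub> T i (T i x)"
      using x(1) Tc S w by (simp add: T_add[symmetric] T_smult[symmetric] w_def minus_add_cancel)
    hence "ip H (T i (w i)) z + ip H (T i S) z = of_real c * ip H (T i (T i x)) z"
      using x(1) z Tc S w by (metis ip_add_left ip_smult_left)
    moreover have "ip H (T i S) z = (\<Sum>j\<in>UNIV. ip H (T i (T j x)) z)"
      unfolding S_def using x(1) Tc z by (simp add: T_sum ip_finsum_left)
    ultimately show ?thesis by (simp add: algebra_simps)
  qed
  have "fun_calc H f T x = (\<Oplus>\<^bsub>H\<^esub>i\<in>UNIV. T i (w i))"
  proof (rule eqI_ip)
    fix z assume z: "z \<in> carrier H"
    show "ip H (fun_calc H f T x) z = ip H (\<Oplus>\<^bsub>H\<^esub>i\<in>UNIV. T i (w i)) z"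
      unfolding fc(2)[OF z] a_def sum_weighted_form using w Tc z
      by (simp add: ip_finsum_left ip_Tw sum_subtractf sum_distrib_left)
  qed (use w Tc fc(1) in \<open>auto intro!: finsum_closed\<close>)
  also have "hnorm H \<dots> \<le> (\<Sum>i\<in>UNIV. hnorm H (T i (w i)))"
    using w Tc by (intro hnorm_finsum_le) auto
  also have "\<dots> \<le> (\<Sum>i\<in>UNIV. hnorm H (w i))"
    by (intro sum_mono contraction_bound lin contr w)
  finally have le1: "hnorm H (fun_calc H f T x) \<le> (\<Sum>i\<in>UNIV. hnorm H (w i))" .
  have le_w: "(\<Sum>i\<in>UNIV. (hnorm H (w i))\<^sup>2) \<le> c\<^sup>2 * (\<Sum>i\<in>UNIV. (hnorm H (T i x))\<^sup>2)"
    unfolding w_def S_def using x Tc c by (intro sum_hnorm_scaled_minus_sum_le) auto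
  have "(hnorm H (T i x))\<^sup>2 \<le> 1" for i
    using contraction_bound[OF lin[of i] contr x(1)] x(2) Tc[OF x(1), of i] by (simp add: power_le_one)
  hence le_T: "(\<Sum>i\<in>UNIV. (hnorm H (T i x))\<^sup>2) \<le> real CARD('d)"
    using sum_mono[of "UNIV :: 'd set" "\<lambda>i. (hnorm H (T i x))\<^sup>2" "\<lambda>_. 1"] by simp
  \<comment> \<open>Cauchy-Schwarz over the d indices passes from the sum of norms to the sum of
    squares, where the bound for c I - J applies.\<close>
  have "(\<Sum>i\<in>UNIV. hnorm H (w i))\<^sup>2 \<le> real CARD('d) * (\<Sum>i\<in>UNIV. (hnorm H (w i))\<^sup>2)"
    using sum_squared_le_sum_of_squares[of "\<lambda>i. hnorm H (w i)" "UNIV :: 'd set"]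
    by (simp add: mult.commute)
  also have "\<dots> \<le> real CARD('d) * (c\<^sup>2 * real CARD('d))"
    by (intro mult_left_mono order.trans[OF le_w] le_T) auto
  finally have "(\<Sum>i\<in>UNIV. hnorm H (w i))\<^sup>2 \<le> (c * real CARD('d))\<^sup>2"
    by (simp add: power2_eq_square algebra_simps)
  hence "(\<Sum>i\<in>UNIV. hnorm H (w i)) \<le> c * real CARD('d)"
    by (rule power2_le_imp_le) (use c in auto)
  with le1 show "hnorm H (fun_calc H f T x) \<le> c * real CARD('d)" by simp
qed

section \<open>A commuting tuple attaining the bound\<close>

text \<open>The Euclidean space C^n transported along an injection \<open>h\<close>, so that its
  carrier lies in the prescribed universe; \<open>inv_into UNIV h\<close> recovers the
  coordinates.\<close>

definition vec_hilbert :: "(complex ^ 'n::finite \<Rightarrow> 'a) \<Rightarrow> 'a hilbert" where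
  "vec_hilbert h = \<lparr>carrier = range h, monoid.mult = undefined, one = undefined,
     ring.zero = h 0, add = (\<lambda>x y. h (inv_into UNIV h x + inv_into UNIV h y)),
     smult = (\<lambda>a x. h (a *s inv_into UNIV h x)),
     ip = (\<lambda>x y. \<Sum>i\<in>UNIV. inv_into UNIV h x $ i * cnj (inv_into UNIV h y $ i))\<rparr>"

context
  fixes h :: "complex ^ 'n::finite \<Rightarrow> 'a"
  assumes h: "inj h"
begin

lemma vec_hilbert_simps:
  "carrier (vec_hilbert h) = range h"
  "\<zero>\<^bsub>vec_hilbert h\<^esub> = h 0"
  "h x \<oplus>\<^bsub>vec_hilbert h\<^esub> h y = h (x + y)"
  "a \<odot>\<^bsub>vec_hilbert h\<^esub> h x = h (a *s x)"
  "ip (vec_hilbert h) (h x) (h y) = (\<Sum>i\<in>UNIV. x $ i * cnj (y $ i))"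
  using h by (simp_all add: vec_hilbert_def)

lemma hnorm_vec_hilbert: "hnorm (vec_hilbert h) (h x) = norm x"
proof -
  have "Re (z * cnj z) = (cmod z)\<^sup>2" for z
    by (simp flip: complex_norm_square)
  thus ?thesis
    by (simp add: hnorm_def vec_hilbert_simps norm_vec_def L2_set_def)
qed

lemma module_vec_hilbert: "module ring_of_type_algebra (vec_hilbert h)"
proof (rule moduleI)
  show "abelian_group (vec_hilbert h)"
  proof (rule abelian_groupI)
    fix x assume "x \<in> carrier (vec_hilbert h)"
    then obtain u where "x = h u" by (auto simp: vec_hilbert_simps)
    thus "\<exists>y\<in>carrier (vec_hilbert h). y \<oplus>\<^bsub>vec_hilbert h\<^esub> x = \<zero>\<^bsub>vec_hilbert h\<^esub>"
      by (intro bexI[of _ "h (- u)"]) (auto simp: vec_hilbert_simps)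
  qed (auto simp: vec_hilbert_simps add_ac)
qed (auto simp: vec_hilbert_simps ring_of_type_algebra_def[where 'a = complex] vec_eq_iff algebra_simps
      intro: cring_from_type_algebra[unfolded ring_of_type_algebra_def] arg_cong[where f = h])

lemma hdist_vec_hilbert: "hdist (vec_hilbert h) (h x) (h y) = dist x y"
proof -
  interpret M: module ring_of_type_algebra "vec_hilbert h" by (rule module_vec_hilbert)
  have "\<ominus>\<^bsub>vec_hilbert h\<^esub> h y = h (- y)"
    by (rule M.minus_equality) (auto simp: vec_hilbert_simps)
  thus ?thesis
    by (simp add: hdist_def a_minus_def vec_hilbert_simps hnorm_vec_hilbert dist_norm)
qed

text \<open>\<open>Metric_space_hdist\<close> presupposes a Hilbert space, and completeness is still
  to be shown here. The metric axioms are therefore transported from the Euclidean distance, as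
  completeness will be.\<close>

lemma Metric_space_vec_hilbert:
  "Metric_space (carrier (vec_hilbert h)) (hdist (vec_hilbert h))"
proof
  fix x y z
  assume "x \<in> carrier (vec_hilbert h)" "y \<in> carrier (vec_hilbert h)" "z \<in> carrier (vec_hilbert h)"
  thus "hdist (vec_hilbert h) x z \<le> hdist (vec_hilbert h) x y + hdist (vec_hilbert h) y z"
    by (auto simp: vec_hilbert_simps hdist_vec_hilbert dist_triangle)
next
  fix x y assume "x \<in> carrier (vec_hilbert h)" "y \<in> carrier (vec_hilbert h)"
  thus "hdist (vec_hilbert h) x y = 0 \<longleftrightarrow> x = y"
    using h by (auto simp: vec_hilbert_simps hdist_vec_hilbert inj_eq)
next
  fix x y :: 'a
  have "0 \<le> hdist (vec_hilbert h) x y \<and> hdist (vec_hilbert h) x y = hdist (vec_hilbert h) y x"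
  proof (cases "x \<in> range h \<and> y \<in> range h")
    case True
    thus ?thesis by (auto simp: hdist_vec_hilbert dist_commute)
  next
    case False
    thus ?thesis by (auto simp: hdist_def vec_hilbert_simps)
  qed
  thus "0 \<le> hdist (vec_hilbert h) x y" "hdist (vec_hilbert h) x y = hdist (vec_hilbert h) y x"
    by auto
qed

lemma complex_hilbert_space_vec_hilbert: "complex_hilbert_space (vec_hilbert h)"
proof -
  interpret M: module ring_of_type_algebra "vec_hilbert h" by (rule module_vec_hilbert)
  interpret MS: Metric_space "carrier (vec_hilbert h)" "hdist (vec_hilbert h)"
    by (rule Metric_space_vec_hilbert)
  show ?thesis
  proof
    fix x assume "x \<in> carrier (vec_hilbert h)" "x \<noteq> \<zero>\<^bsub>vec_hilbert h\<^esub>"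
    then obtain u where u: "x = h u" "u \<noteq> 0" by (auto simp: vec_hilbert_simps)
    hence "hnorm (vec_hilbert h) x > 0" by (simp add: hnorm_vec_hilbert)
    thus "Re (ip (vec_hilbert h) x x) > 0" by (simp add: hnorm_def)
  next
    show "MS.mcomplete"
      unfolding MS.mcomplete_def
    proof (intro allI impI)
      fix \<sigma> assume \<sigma>: "MS.MCauchy \<sigma>"
      define u where "u n = inv_into UNIV h (\<sigma> n)" for n
      have "range \<sigma> \<subseteq> carrier (vec_hilbert h)"
        using \<sigma> unfolding MS.MCauchy_def by blast
      hence "\<sigma> n \<in> range h" for n
        by (auto simp: vec_hilbert_simps)
      hence u: "\<sigma> n = h (u n)" for n
        by (simp add: u_def f_inv_into_f)
      have "Cauchy u"
        using \<sigma> unfolding MS.MCauchy_def Cauchy_def u hdist_vec_hilbert by metis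
      then obtain l where "u \<longlonglongrightarrow> l"
        using Cauchy_convergent convergent_def by blast
      hence "limitin MS.mtopology \<sigma> (h l) sequentially"
        unfolding MS.limit_metric_sequentially u hdist_vec_hilbert
        by (auto simp: vec_hilbert_simps lim_sequentially)
      thus "\<exists>x. limitin MS.mtopology \<sigma> x sequentially" ..
    qed
  qed (auto simp: vec_hilbert_simps sum.distrib sum_distrib_left algebra_simps)
qed

end

text \<open>Strict contractions and points of the open polydisc only approach the extremal
  configuration. Scaling it by r < 1 multiplies a quadratic form by r^2, and r then tends to
  1.\<close>

lemma ereal_scaled_limit_le:
  assumes "\<And>r. 0 \<le> r \<Longrightarrow> r < 1 \<Longrightarrow> ereal (r\<^sup>2 * b) \<le> B"
  shows "ereal b \<le> B"
proof (rule tendsto_upperbound)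
  have "((\<lambda>r::real. r\<^sup>2 * b) \<longlongrightarrow> 1\<^sup>2 * b) (at_left 1)"
    by (intro tendsto_intros)
  thus "((\<lambda>r. ereal (r\<^sup>2 * b)) \<longlongrightarrow> ereal b) (at_left 1)"
    by simp
  have "eventually (\<lambda>r::real. r \<in> {0<..<1}) (at_left 1)"
    by (rule eventually_at_leftI[of 0]) auto
  thus "eventually (\<lambda>r. ereal (r\<^sup>2 * b) \<le> B) (at_left 1)"
    by eventually_elim (auto intro: assms)
qed simp

section \<open>Commuting operators on C^4 built from roots of unity\<close>

lemma ex_unit_vectors_sum_zero:
  assumes "CARD('d::finite) > 1"
  obtains u :: "'d::finite \<Rightarrow> complex" where "\<And>i. cmod (u i) = 1" "sum u UNIV = 0"
proof -
  let ?R = "{z::complex. z ^ CARD('d) = 1}"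
  have "finite ?R" "card (UNIV :: 'd set) = card ?R"
    using assms by (auto simp: finite_roots_unity card_roots_unity_eq)
  then obtain u :: "'d \<Rightarrow> complex" where u: "bij_betw u UNIV ?R"
    using finite_same_card_bij[of "UNIV :: 'd set" ?R] by auto
  have "sum u UNIV = \<Sum>?R"
    using sum.reindex_bij_betw[OF u, of "\<lambda>z. z"] by simp
  hence "sum u UNIV = 0"
    using sum_roots_unity[OF assms] by simp
  moreover have "cmod (u i) = 1" for i
  proof -
    have "u i ^ CARD('d) = 1" using u by (auto simp: bij_betw_def)
    hence "cmod (u i) ^ CARD('d) = 1" by (metis norm_one norm_power)
    thus ?thesis using assms power_eq_imp_eq_base[of "cmod (u i)" "CARD('d)" 1] by simp
  qed
  ultimately show ?thesis using that by blast
qed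

text \<open>
  The operator $r T$ for the vector $u$ of the plane, in the basis $e$, $1$, $\mathrm{i}$, $f$.
\<close>

definition spin :: "real \<Rightarrow> complex \<Rightarrow> complex ^ 4 \<Rightarrow> complex ^ 4" where
  "spin r u x = (\<chi> k. if k = 1 then 0
     else if k = 2 then of_real (r * Re u) * x $ 1
     else if k = 3 then of_real (r * Im u) * x $ 1
     else of_real (r * Re u) * x $ 2 + of_real (r * Im u) * x $ 3)"

lemma spin_nth:
  "spin r u x $ 1 = 0"
  "spin r u x $ 2 = of_real (r * Re u) * x $ 1"
  "spin r u x $ 3 = of_real (r * Im u) * x $ 1"
  "spin r u x $ 4 = of_real (r * Re u) * x $ 2 + of_real (r * Im u) * x $ 3"
  by (simp_all add: spin_def)

lemma norm_complex_vec4_sq: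
  fixes x :: "complex ^ 4"
  shows "(norm x)\<^sup>2 = (cmod (x $ 1))\<^sup>2 + (cmod (x $ 2))\<^sup>2 + (cmod (x $ 3))\<^sup>2 + (cmod (x $ 4))\<^sup>2"
  unfolding norm_vec_def L2_set_def
  by (subst real_sqrt_pow2) (simp_all only: sum_4, simp)

text \<open>The first coordinate is sent to r times a multiple of the unit vector u in coordinates 2
  and 3; these two coordinates are sent to coordinate 4 by pairing with r u, which is bounded by
  Cauchy-Schwarz. The two images are orthogonal, so the squares add up.\<close>

lemma norm_spin_le:
  assumes "cmod u = 1" "0 \<le> r"
  shows "norm (spin r u x) \<le> r * norm x"
proof (rule power2_le_imp_le)
  have u: "(Re u)\<^sup>2 + (Im u)\<^sup>2 = 1"
    using assms(1) by (simp add: cmod_def)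
  let ?a = "cmod (x $ 2)" and ?b = "cmod (x $ 3)"
  have "cmod (of_real (Re u) * x $ 2 + of_real (Im u) * x $ 3) \<le> \<bar>Re u\<bar> * ?a + \<bar>Im u\<bar> * ?b"
    by (rule order.trans[OF norm_triangle_ineq]) (simp add: norm_mult)
  hence "(cmod (of_real (Re u) * x $ 2 + of_real (Im u) * x $ 3))\<^sup>2
      \<le> (\<bar>Re u\<bar> * ?a + \<bar>Im u\<bar> * ?b)\<^sup>2"
    by (rule power_mono) simp
  \<comment> \<open>The added square completes Lagrange's identity.\<close>
  also have "\<dots> \<le> (\<bar>Re u\<bar> * ?a + \<bar>Im u\<bar> * ?b)\<^sup>2 + (\<bar>Im u\<bar> * ?a - \<bar>Re u\<bar> * ?b)\<^sup>2"
    by simp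
  also have "\<dots> = ((Re u)\<^sup>2 + (Im u)\<^sup>2) * (?a\<^sup>2 + ?b\<^sup>2)"
    by (simp add: power2_sum power2_diff power_mult_distrib algebra_simps)
  finally have le: "(cmod (of_real (Re u) * x $ 2 + of_real (Im u) * x $ 3))\<^sup>2 \<le> ?a\<^sup>2 + ?b\<^sup>2"
    using u by simp
  have "(norm (spin r u x))\<^sup>2 = r\<^sup>2 * (((Re u)\<^sup>2 + (Im u)\<^sup>2) * (cmod (x $ 1))\<^sup>2
      + (cmod (of_real (Re u) * x $ 2 + of_real (Im u) * x $ 3))\<^sup>2)"
  proof -
    have "of_real (r * Re u) * x $ 2 + of_real (r * Im u) * x $ 3
        = of_real r * (of_real (Re u) * x $ 2 + of_real (Im u) * x $ 3)"
      by (simp add: algebra_simps)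
    thus ?thesis
      unfolding norm_complex_vec4_sq spin_nth
      by (simp only: norm_mult norm_of_real power_mult_distrib power2_abs abs_mult)
        (simp add: algebra_simps)
  qed
  also have "\<dots> \<le> r\<^sup>2 * (norm x)\<^sup>2"
    unfolding norm_complex_vec4_sq u using le zero_le_power2[of "cmod (x $ 4)"]
    by (intro mult_left_mono zero_le_power2) linarith
  finally show "(norm (spin r u x))\<^sup>2 \<le> (r * norm x)\<^sup>2"
    by (simp add: power_mult_distrib)
qed (use assms in auto)

lemma spin_linear: "spin r u (x + y) = spin r u x + spin r u y" "spin r u (a *s x) = a *s spin r u x"
  by (simp_all only: vec_eq_iff forall_4 spin_nth vector_add_component vector_smult_component)
    (simp_all add: algebra_simps)

text \<open>Either product sends e to r^2 <u, v> f and kills the other basis vectors, and the real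
  inner product <u, v> is symmetric.\<close>

lemma spin_commute: "spin r u (spin r v x) = spin r v (spin r u x)"
  by (simp only: vec_eq_iff forall_4 spin_nth) (simp add: algebra_simps)

lemma spin_spin_axis:
  "spin r u (spin r v (axis 1 1)) = of_real (r\<^sup>2 * (Re u * Re v + Im u * Im v)) *s axis 4 1"
  by (simp only: vec_eq_iff forall_4 spin_nth vector_smult_component)
    (simp add: algebra_simps power2_eq_square axis_def)

lemma agler_norm_ge_scaled:
  fixes f :: "complex ^ 'd::finite \<Rightarrow> complex" and h :: "complex ^ 4 \<Rightarrow> 'a"
  assumes h: "inj h" and d: "CARD('d) > 1" and r: "0 \<le> r" "r < 1" and "\<kappa> \<ge> 0" "c \<ge> 0"
    and f: "\<And>z. f z = of_real \<kappa> * (of_real c * (\<Sum>m\<in>UNIV. (z $ m)\<^sup>2) - (\<Sum>m\<in>UNIV. z $ m)\<^sup>2)"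
  shows "ereal (r\<^sup>2 * (\<kappa> * c * real CARD('d))) \<le> agler_norm TYPE('a) f"
proof -
  obtain u :: "'d \<Rightarrow> complex" where u: "\<And>i. cmod (u i) = 1" "sum u UNIV = 0"
    using ex_unit_vectors_sum_zero[OF d] by blast
  define H where "H = vec_hilbert h"
  define T where "T i x = h (spin r (u i) (inv_into UNIV h x))" for i x
  note H_simps = vec_hilbert_simps[OF h, folded H_def]
  have T: "T i (h x) = h (spin r (u i) x)" for i x
    using h by (simp add: T_def)
  interpret complex_hilbert_space H
    unfolding H_def by (rule complex_hilbert_space_vec_hilbert[OF h])
  have norm_h: "hnorm H (h x) = norm x" for x
    unfolding H_def by (rule hnorm_vec_hilbert[OF h])
  have "op_norm H (T i) \<le> ereal r" for i
  proof (rule op_norm_leI)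
    fix x assume "x \<in> carrier H" "hnorm H x \<le> 1"
    then obtain v where v: "x = h v" "norm v \<le> 1" by (auto simp: H_simps norm_h)
    have "norm (spin r (u i) v) \<le> r * norm v" by (rule norm_spin_le[OF u(1) r(1)])
    also have "\<dots> \<le> r * 1" using v r by (intro mult_left_mono) auto
    finally show "hnorm H (T i x) \<le> r" by (simp add: v T norm_h)
  qed
  hence "op_norm H (T i) < 1" for i
    using r(2) le_less_trans[of "op_norm H (T i)" "ereal r" 1] by simp
  moreover have "linear_operator H (T i)" for i
    unfolding linear_operator_def H_simps(1) by (auto simp: H_simps T spin_linear)
  moreover have "T i (T j x) = T j (T i x)" if "x \<in> carrier H" for i j x
    using that unfolding H_simps(1) by (auto simp: T spin_commute[of r "u i" "u j"])
  ultimately have csc: "commuting_strict_contractions H T"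
    by (simp add: commuting_strict_contractions_def)
  define a :: "'d \<Rightarrow> 'd \<Rightarrow> complex"
    where "a i j = of_real \<kappa> * ((if i = j then of_real c else 0) - 1)" for i j
  have fq: "f z = (\<Sum>i\<in>UNIV. \<Sum>j\<in>UNIV. a i j * (z $ i * z $ j))" for z
    unfolding f a_def sum_weighted_form by (simp add: power2_eq_square sum_product)
  define e where "e = h (axis 1 1)"
  have e: "e \<in> carrier H" "hnorm H e = 1"
    by (auto simp: e_def H_simps norm_h norm_axis_1)
  define b where "b = r\<^sup>2 * (\<kappa> * c * real CARD('d))"
  note fc = fun_calc_quadratic[OF csc complex_hilbert_space_axioms fq e(1)]
  have "fun_calc H f T e = h (of_real b *s axis 4 1)"
  proof (rule eqI_ip)
    fix z assume "z \<in> carrier H"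
    then obtain w where w: "z = h w" by (auto simp: H_simps)
    have ip4: "ip H (h (t *s axis 4 1)) z = t * cnj (w $ 4)" for t
      by (simp add: w H_simps axis_def if_distrib[of "\<lambda>x. _ * x"] if_distrib[of "\<lambda>x. x * _"] cong: if_cong)
    have g: "ip H (T i (T j e)) z = of_real (r\<^sup>2 * (Re (u i) * Re (u j) + Im (u i) * Im (u j))) * cnj (w $ 4)" for i j
      unfolding e_def T spin_spin_axis ip4 ..
    \<comment> \<open>The double sum of the inner products <u_i, u_j> is the squared length of the
      sum of the u_i, hence 0; only the diagonal part of the form, with |u_i| = 1, contributes to
      \<open>b\<close>.\<close>
    have "(\<Sum>i\<in>UNIV. \<Sum>j\<in>UNIV. r\<^sup>2 * (Re (u i) * Re (u j) + Im (u i) * Im (u j)))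
        = r\<^sup>2 * ((Re (sum u UNIV))\<^sup>2 + (Im (sum u UNIV))\<^sup>2)"
      unfolding Re_sum Im_sum power2_eq_square[of "sum _ _"] sum_product
      by (simp only: sum_distrib_left sum.distrib distrib_left)
    hence s0: "(\<Sum>i\<in>UNIV. \<Sum>j\<in>UNIV. r\<^sup>2 * (Re (u i) * Re (u j) + Im (u i) * Im (u j))) = 0"
      by (simp only: u(2)) simp
    have 0: "(\<Sum>i\<in>UNIV. \<Sum>j\<in>UNIV. ip H (T i (T j e)) z) = 0"
      unfolding g sum_distrib_right[symmetric] of_real_sum[symmetric] s0 by simp
    have "Re (u i) * Re (u i) + Im (u i) * Im (u i) = 1" for i
      using u(1)[of i] by (simp add: cmod_def power2_eq_square)
    hence 1: "(\<Sum>i\<in>UNIV. ip H (T i (T i e)) z) = of_real (r\<^sup>2 * real CARD('d)) * cnj (w $ 4)"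
      unfolding g by simp
    show "ip H (fun_calc H f T e) z = ip H (h (of_real b *s axis 4 1)) z"
      unfolding fc(2)[OF \<open>z \<in> carrier H\<close>] a_def sum_weighted_form 0 1 ip4 b_def by simp
  qed (use fc(1) in \<open>auto simp: H_simps\<close>)
  moreover have "norm (complex_of_real b *s (axis 4 1 :: complex ^ 4)) = b"
  proof (rule power2_eq_imp_eq)
    show "(norm (complex_of_real b *s (axis 4 1 :: complex ^ 4)))\<^sup>2 = b\<^sup>2"
      by (simp add: norm_complex_vec4_sq axis_def)
    show "b \<ge> 0" using assms(5,6) by (simp add: b_def)
  qed simp
  ultimately have "hnorm H (fun_calc H f T e) = b"
    by (simp add: norm_h)
  hence "ereal b \<le> op_norm H (fun_calc H f T)"
    unfolding op_norm_def using e by (intro SUP_upper2[of e]) auto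
  also have "\<dots> \<le> agler_norm TYPE('a) f"
    unfolding agler_norm_def using csc complex_hilbert_space_axioms by (intro SUP_upper2[of "(H, T)"]) auto
  finally show ?thesis by (simp add: b_def)
qed

text \<open>The infinite set C is equipotent to C x C; applying such a pairing twice codes four
  coordinates by one complex number.\<close>

lemma ex_inj_vec4:
  assumes "hilbert_universe TYPE('a)"
  obtains h :: "complex ^ 4 \<Rightarrow> 'a" where "inj h"
proof -
  have "\<not> finite (UNIV :: complex set)"
    by (rule infinite_UNIV_char_0)
  hence "\<exists>q. bij_betw q (UNIV \<times> UNIV :: (complex \<times> complex) set) (UNIV :: complex set)"
    unfolding card_of_ordIso by (rule card_of_Times_same_infinite)
  then obtain q :: "complex \<times> complex \<Rightarrow> complex" where q: "inj q"
    by (auto simp: bij_betw_def)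
  obtain g :: "complex \<Rightarrow> 'a" where g: "inj g"
    using assms by (auto simp: hilbert_universe_def)
  have "inj (\<lambda>x :: complex ^ 4. g (q (q (x $ 1, x $ 2), q (x $ 3, x $ 4))))"
    using g q by (intro injI) (simp only: inj_eq prod.inject vec_eq_iff forall_4)
  thus ?thesis using that by blast
qed

lemma agler_norm_ge:
  fixes f :: "complex ^ 'd::finite \<Rightarrow> complex"
  assumes "hilbert_universe TYPE('a)" and "CARD('d) > 1" and "\<kappa> \<ge> 0" "c \<ge> 0"
    and "\<And>z. f z = of_real \<kappa> * (of_real c * (\<Sum>m\<in>UNIV. (z $ m)\<^sup>2) - (\<Sum>m\<in>UNIV. z $ m)\<^sup>2)"
  shows "ereal (\<kappa> * c * real CARD('d)) \<le> agler_norm TYPE('a) f"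
proof -
  obtain h :: "complex ^ 4 \<Rightarrow> 'a" where "inj h"
    using ex_inj_vec4[OF assms(1)] .
  thus ?thesis
    by (intro ereal_scaled_limit_le[of "\<kappa> * c * real CARD('d)"] agler_norm_ge_scaled[OF _ assms(2) _ _ assms(3-5)])
qed

section \<open>The supremum norm\<close>

text \<open>The operator estimate for scalars, with p(z) = sum z_i w_i. Here the term with |S|^2,
  which the operator version discards, is kept: it yields the strict inequality whenever the
  coordinates do not sum to 0.\<close>

lemma cmod_form_le:
  fixes z :: "complex ^ 'd::finite" and c :: real
  assumes z: "\<And>i. cmod (z $ i) \<le> 1"
  shows "(cmod (of_real c * (\<Sum>m\<in>UNIV. (z $ m)\<^sup>2) - (\<Sum>m\<in>UNIV. z $ m)\<^sup>2))\<^sup>2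
    \<le> (c * real CARD('d))\<^sup>2 - real CARD('d) * (2 * c - real CARD('d)) * (cmod (\<Sum>m\<in>UNIV. z $ m))\<^sup>2"
proof -
  define S where "S = (\<Sum>m\<in>UNIV. z $ m)"
  define w where "w i = of_real c * z $ i - S" for i
  let ?d = "real CARD('d)"
  have "of_real c * (\<Sum>m\<in>UNIV. (z $ m)\<^sup>2) - S\<^sup>2 = (\<Sum>i\<in>UNIV. z $ i * w i)"
    by (simp add: w_def algebra_simps power2_eq_square sum_subtractf sum_distrib_left[symmetric]
        sum_distrib_right[symmetric] S_def[symmetric])
  also have "cmod \<dots> \<le> (\<Sum>i\<in>UNIV. cmod (w i))"
    using z by (intro sum_norm_le) (simp add: norm_mult mult_left_le_one_le)
  finally have "(cmod (of_real c * (\<Sum>m\<in>UNIV. (z $ m)\<^sup>2) - S\<^sup>2))\<^sup>2 \<le> (\<Sum>i\<in>UNIV. cmod (w i))\<^sup>2"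
    by (rule power_mono) simp
  also have "\<dots> \<le> ?d * (\<Sum>i\<in>UNIV. (cmod (w i))\<^sup>2)"
    using sum_squared_le_sum_of_squares[of "\<lambda>i. cmod (w i)" "UNIV :: 'd set"] by (simp add: mult.commute)
  also have "(\<Sum>i\<in>UNIV. (cmod (w i))\<^sup>2)
      = (\<Sum>i\<in>UNIV. c\<^sup>2 * (cmod (z $ i))\<^sup>2 - 2 * c * Re (z $ i * cnj S) + (cmod S)\<^sup>2)"
    unfolding w_def cmod_power2
    by (intro sum.cong refl) (simp add: power2_eq_square algebra_simps)
  also have "\<dots> = c\<^sup>2 * (\<Sum>i\<in>UNIV. (cmod (z $ i))\<^sup>2) - 2 * c * Re (S * cnj S) + ?d * (cmod S)\<^sup>2"
    unfolding sum.distrib sum_subtractf sum_distrib_left[symmetric] Re_sum[symmetric]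
      sum_distrib_right[symmetric] S_def[symmetric] by simp
  also have "Re (S * cnj S) = (cmod S)\<^sup>2"
    by (simp flip: complex_norm_square)
  finally have "(cmod (of_real c * (\<Sum>m\<in>UNIV. (z $ m)\<^sup>2) - S\<^sup>2))\<^sup>2
      \<le> ?d * (c\<^sup>2 * (\<Sum>i\<in>UNIV. (cmod (z $ i))\<^sup>2)) - ?d * (2 * c - ?d) * (cmod S)\<^sup>2"
    by (simp add: algebra_simps)
  moreover have "(\<Sum>i\<in>(UNIV::'d set). (cmod (z $ i))\<^sup>2) \<le> (\<Sum>i\<in>(UNIV::'d set). 1)"
    using z by (intro sum_mono) (simp add: power_le_one)
  hence "?d * (c\<^sup>2 * (\<Sum>i\<in>UNIV. (cmod (z $ i))\<^sup>2)) \<le> ?d * (c\<^sup>2 * ?d)"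
    by (intro mult_left_mono) auto
  ultimately show ?thesis
    unfolding S_def[symmetric] by (simp add: power_mult_distrib power2_eq_square algebra_simps)
qed

text \<open>A nonzero sum S makes the subtracted term of \<open>cmod_form_le\<close> positive. If S
  = 0 the form is c Q with |Q| at most d, and equality would make all z_m^2 equal and nonzero, so
  that z_m = +-y; a zero sum then needs equally many signs of each kind, against d odd.\<close>

lemma cmod_form_less:
  fixes z :: "complex ^ 'd::finite" and c :: real
  assumes z: "\<And>i. cmod (z $ i) \<le> 1" and c: "c > 0" "real CARD('d) < 2 * c" and odd: "odd CARD('d)"
  shows "cmod (of_real c * (\<Sum>m\<in>UNIV. (z $ m)\<^sup>2) - (\<Sum>m\<in>UNIV. z $ m)\<^sup>2) < c * real CARD('d)"
proof (cases "(\<Sum>m\<in>UNIV. z $ m) = 0")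
  case False
  hence "real CARD('d) * (2 * c - real CARD('d)) * (cmod (\<Sum>m\<in>UNIV. z $ m))\<^sup>2 > 0"
    using c by simp
  with cmod_form_le[of z c, OF z]
  have "(cmod (of_real c * (\<Sum>m\<in>UNIV. (z $ m)\<^sup>2) - (\<Sum>m\<in>UNIV. z $ m)\<^sup>2))\<^sup>2
      < (c * real CARD('d))\<^sup>2" by linarith
  thus ?thesis
    by (rule power2_less_imp_less) (use c in auto)
next
  case True
  define Q where "Q = (\<Sum>m\<in>UNIV. (z $ m)\<^sup>2)"
  have Q_le: "cmod Q \<le> real CARD('d)"
  proof -
    have "cmod Q \<le> (\<Sum>m\<in>(UNIV::'d set). 1)"
      unfolding Q_def using z by (intro sum_norm_le) (simp add: norm_power power_le_one)
    thus ?thesis by simp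
  qed
  have "cmod Q \<noteq> real CARD('d)"
  proof
    assume Q: "cmod Q = real CARD('d)"
    hence "Q \<noteq> 0" by auto
    \<comment> \<open>The unimodular factor that rotates Q onto the positive axis. The real parts of
      v z_m^2 are at most 1 and add up to d, so each of them equals 1.\<close>
    define v where "v = cnj Q / of_real (cmod Q)"
    have v: "cmod v = 1" using \<open>Q \<noteq> 0\<close> by (simp add: v_def norm_divide)
    have "v * Q = of_real (cmod Q)"
      using \<open>Q \<noteq> 0\<close> complex_norm_square[of Q] by (simp add: v_def field_simps power2_eq_square)
    hence "Re (v * Q) = real CARD('d)" using Q by simp
    hence "(\<Sum>m\<in>UNIV. 1 - Re (v * (z $ m)\<^sup>2)) = 0"
      by (simp add: Q_def sum_distrib_left sum_subtractf)
    moreover have cm: "cmod (v * (z $ m)\<^sup>2) \<le> 1" for m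
      using v z[of m] by (simp add: norm_mult norm_power power_le_one)
    have "Re (v * (z $ m)\<^sup>2) \<le> 1" for m
      using complex_Re_le_cmod[of "v * (z $ m)\<^sup>2"] cm[of m] by linarith
    ultimately have Re1: "Re (v * (z $ m)\<^sup>2) = 1" for m
      by (subst (asm) sum_nonneg_eq_0_iff) (auto simp: le_diff_eq)
    have eq1: "v * (z $ m)\<^sup>2 = 1" for m
    proof -
      \<comment> \<open>Real part 1 and modulus at most 1 leave no room for an imaginary
        part.\<close>
      have "(cmod (v * (z $ m)\<^sup>2))\<^sup>2 \<le> 1" using cm[of m] by (simp add: power_le_one)
      hence "(Im (v * (z $ m)\<^sup>2))\<^sup>2 \<le> 0"
        using Re1[of m] unfolding cmod_power2 by simp
      thus ?thesis using Re1[of m] by (simp add: complex_eq_iff)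
    qed
    \<comment> \<open>\<open>undefined\<close> serves as an arbitrary reference index.\<close>
    define y where "y = z $ undefined"
    have "v \<noteq> 0" using v by auto
    have "y \<noteq> 0" using eq1[of undefined] by (auto simp: y_def)
    have "(z $ m)\<^sup>2 = y\<^sup>2" for m
      using eq1[of m] eq1[of undefined] \<open>v \<noteq> 0\<close> unfolding y_def by (metis mult_left_cancel)
    hence pm: "z $ m = y \<or> z $ m = - y" for m
      by (simp add: power2_eq_iff)
    \<comment> \<open>The indices with the minus sign: the coordinates sum to (d - 2 |M|) y.\<close>
    define M where "M = {m. z $ m \<noteq> y}"
    have "z $ m = y - (if m \<in> M then 2 * y else 0)" for m
      using pm[of m] by (auto simp: M_def)
    hence "(\<Sum>m\<in>UNIV. z $ m) = of_nat CARD('d) * y - of_nat (card M) * (2 * y)"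
      by (simp add: sum_subtractf sum.If_cases)
    hence "of_nat CARD('d) * y = of_nat (2 * card M) * y"
      using True by (simp add: mult_ac)
    hence "CARD('d) = 2 * card M"
      using \<open>y \<noteq> 0\<close> by (metis mult_right_cancel of_nat_eq_iff)
    thus False using odd by simp
  qed
  with Q_le have "cmod Q < real CARD('d)" by simp
  thus ?thesis
    using True c by (simp add: Q_def[symmetric] norm_mult)
qed

lemma sup_norm_form_le:
  fixes p :: "complex ^ 'd::finite \<Rightarrow> complex"
  assumes c: "real CARD('d) \<le> 2 * c"
    and p: "\<And>z. p z = of_real c * (\<Sum>m\<in>UNIV. (z $ m)\<^sup>2) - (\<Sum>m\<in>UNIV. z $ m)\<^sup>2"
  shows "sup_norm p \<le> ereal (c * real CARD('d))"
  unfolding sup_norm_def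
proof (rule SUP_least)
  fix z :: "complex ^ 'd" assume "z \<in> polydisc"
  hence z: "cmod (z $ i) \<le> 1" for i by (auto simp: polydisc_def intro: less_imp_le)
  have "real CARD('d) * (2 * c - real CARD('d)) * (cmod (\<Sum>m\<in>UNIV. z $ m))\<^sup>2 \<ge> 0"
    using c by simp
  with cmod_form_le[of z c, OF z] have "(cmod (p z))\<^sup>2 \<le> (c * real CARD('d))\<^sup>2"
    unfolding p by linarith
  hence "cmod (p z) \<le> c * real CARD('d)"
    by (rule power2_le_imp_le) (use c in auto)
  thus "ereal (cmod (p z)) \<le> ereal (c * real CARD('d))" by simp
qed

lemma sup_norm_form_ge_even:
  fixes p :: "complex ^ 'd::finite \<Rightarrow> complex"
  assumes "c \<ge> 0" and even: "even CARD('d)"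
    and p: "\<And>z. p z = of_real c * (\<Sum>m\<in>UNIV. (z $ m)\<^sup>2) - (\<Sum>m\<in>UNIV. z $ m)\<^sup>2"
  shows "ereal (c * real CARD('d)) \<le> sup_norm p"
proof (rule ereal_scaled_limit_le)
  fix r :: real assume r: "0 \<le> r" "r < 1"
  obtain M :: "'d set" where M: "card M = CARD('d) div 2"
    using obtain_subset_with_card_n[of "CARD('d) div 2" "UNIV :: 'd set"] by auto
  \<comment> \<open>Half of the coordinates are -r and half are r, so their sum is 0 while all
    squares equal r^2.\<close>
  define z :: "complex ^ 'd" where "z = (\<chi> i. of_real r - (if i \<in> M then 2 * of_real r else 0))"
  have zi: "z $ i = of_real r \<or> z $ i = - of_real r" for i by (simp add: z_def)
  have "cmod (z $ i) < 1" for i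
    using zi[of i] r by auto
  hence "z \<in> polydisc" by (simp add: polydisc_def)
  have "CARD('d) = 2 * card M" using even M by auto
  hence "(\<Sum>m\<in>UNIV. z $ m) = 0"
    by (simp add: z_def sum_subtractf sum.If_cases)
  moreover have "(z $ m)\<^sup>2 = of_real (r\<^sup>2)" for m
    using zi[of m] by auto
  ultimately have "p z = of_real (r\<^sup>2 * (c * real CARD('d)))"
    unfolding p by simp
  hence "cmod (p z) = r\<^sup>2 * (c * real CARD('d))"
    using assms(1) by (simp only: norm_of_real) simp
  thus "ereal (r\<^sup>2 * (c * real CARD('d))) \<le> sup_norm p"
    unfolding sup_norm_def using \<open>z \<in> polydisc\<close> by (intro SUP_upper2[of z]) auto
qed

text \<open>Pointwise strictness need not survive a supremum over the open polydisc. The maximum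
  over the compact closed polydisc is attained, and \<open>cmod_form_less\<close> applies at a
  maximiser.\<close>

lemma sup_norm_form_less_odd:
  fixes p :: "complex ^ 'd::finite \<Rightarrow> complex"
  assumes c: "c > 0" "real CARD('d) < 2 * c" and odd: "odd CARD('d)"
    and p: "\<And>z. p z = of_real c * (\<Sum>m\<in>UNIV. (z $ m)\<^sup>2) - (\<Sum>m\<in>UNIV. z $ m)\<^sup>2"
  shows "sup_norm p < ereal (c * real CARD('d))"
proof -
  define K :: "(complex ^ 'd) set" where "K = {z. \<forall>i. cmod (z $ i) \<le> 1}"
  have "closed K"
    unfolding K_def by (intro closed_Collect_all closed_Collect_le continuous_intros)
  moreover have "bounded K"
  proof (rule boundedI)
    fix z :: "complex ^ 'd" assume "z \<in> K"
    hence "(\<Sum>i\<in>UNIV. cmod (z $ i)) \<le> (\<Sum>i\<in>(UNIV::'d set). 1)"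
      by (intro sum_mono) (auto simp: K_def)
    moreover have "norm z \<le> (\<Sum>i\<in>UNIV. cmod (z $ i))"
      unfolding norm_vec_def by (rule L2_set_le_sum) simp
    ultimately show "norm z \<le> real CARD('d)" by simp
  qed
  ultimately have "compact K" by (simp add: compact_eq_bounded_closed)
  moreover have "K \<noteq> {}" by (auto simp: K_def intro!: exI[of _ 0])
  moreover have "continuous_on K (\<lambda>z. cmod (p z))"
    unfolding p by (intro continuous_intros)
  ultimately obtain z where z: "z \<in> K" "\<And>y. y \<in> K \<Longrightarrow> cmod (p y) \<le> cmod (p z)"
    using continuous_attains_sup[of K "\<lambda>z. cmod (p z)"] by blast
  have "sup_norm p \<le> ereal (cmod (p z))"
    unfolding sup_norm_def by (intro SUP_least) (auto intro!: z simp: K_def polydisc_def less_imp_le)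
  also have "cmod (p z) < c * real CARD('d)"
    unfolding p using z(1) by (intro cmod_form_less c odd) (auto simp: K_def)
  finally show ?thesis by simp
qed

section \<open>Both norms of the form, and its normalisation by the supremum norm\<close>

theorem proposition6p1:
  fixes s :: real and p :: "complex ^ 'd::finite \<Rightarrow> complex"
  assumes "CARD('d) > 1"
    and "s > real CARD('d) / 2 - 1"
    and "\<And>z. p z = of_real (1 + s) * (\<Sum>m\<in>UNIV. (z $ m)^2) - (\<Sum>m\<in>UNIV. z $ m)^2"
    and "hilbert_universe TYPE('a)"
  shows "(even CARD('d) \<longrightarrow> sup_norm p = ereal ((1 + s) * real CARD('d))) \<and>
    (odd CARD('d) \<longrightarrow> sup_norm p < ereal ((1 + s) * real CARD('d))) \<and>
    agler_norm TYPE('a) p = ereal ((1 + s) * real CARD('d)) \<and>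
    (odd CARD('d) \<longrightarrow>
      (\<lambda>z. p z / of_real (real_of_ereal (sup_norm p))) \<notin> schur_agler_class TYPE('a))"
proof (intro conjI impI)
  note p = assms(3)
  have c: "1 + s > 1" "real CARD('d) < 2 * (1 + s)"
    using assms(1,2) by (simp_all add: field_simps)
  show "agler_norm TYPE('a) p = ereal ((1 + s) * real CARD('d))"
  proof (rule antisym)
    show "agler_norm TYPE('a) p \<le> ereal ((1 + s) * real CARD('d))"
      by (rule agler_norm_le[OF _ p]) (use c in simp)
    show "ereal ((1 + s) * real CARD('d)) \<le> agler_norm TYPE('a) p"
      using agler_norm_ge[OF assms(4,1), of 1 "1 + s" p] c p by simp
  qed
  show "sup_norm p = ereal ((1 + s) * real CARD('d))" if "even CARD('d)"
    using sup_norm_form_le[OF _ p] sup_norm_form_ge_even[OF _ that p] c by (intro antisym) auto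
  assume odd: "odd CARD('d)"
  show less: "sup_norm p < ereal ((1 + s) * real CARD('d))"
    by (rule sup_norm_form_less_odd[OF _ c(2) odd p]) (use c in simp)
  \<comment> \<open>A point where p takes the value (1 + s)/4 - 1/4 = s/4, which is positive because
    s > d/2 - 1 and d > 1. It ensures that the normalisation divides by a positive number.\<close>
  define x :: "complex ^ 'd" where "x = axis undefined (1/2)"
  have x: "x \<in> polydisc" by (auto simp: x_def polydisc_def axis_def)
  have sums: "(\<Sum>m\<in>UNIV. (x $ m)\<^sup>2) = 1/4" "(\<Sum>m\<in>UNIV. x $ m) = 1/2"
    by (simp_all add: x_def axis_def if_distrib[of "\<lambda>x. x ^ 2"] power_divide cong: if_cong)
  have "p x = of_real (s / 4)"
    unfolding p sums by (simp add: power2_eq_square field_simps)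
  hence "cmod (p x) = s / 4"
    by (simp only: norm_of_real) (use c in simp)
  hence "ereal (s / 4) \<le> sup_norm p"
    unfolding sup_norm_def using x c by (intro SUP_upper2[of x]) auto
  with less c obtain t where t: "sup_norm p = ereal t" "t > 0" "t < (1 + s) * real CARD('d)"
    by (cases "sup_norm p") auto
  have "1 < (1 + s) * real CARD('d) / t"
    using t by (simp add: field_simps)
  \<comment> \<open>The lower bound for \<kappa> = 1/t; this is why \<open>agler_norm_ge\<close>
    carries a scalar factor.\<close>
  also have "ereal ((1 + s) * real CARD('d) / t) \<le> agler_norm TYPE('a) (\<lambda>z. p z / of_real t)"
    using agler_norm_ge[OF assms(4,1), of "1 / t" "1 + s" "\<lambda>z. p z / of_real t"] c t p by simp
  finally show "(\<lambda>z. p z / of_real (real_of_ereal (sup_norm p))) \<notin> schur_agler_class TYPE('a)"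
    by (auto simp: t schur_agler_class_def not_le one_ereal_def)
qed

end
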